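(* Let $A$ be a finite alphabet. For any cellular automaton $F$ of radius $r$ acting on $A^{\mathbb{Z}^2}$, any $F$-invariant probability measure $\mu$, and any $i\ge 0$, $$ER_\mu(\mathcal{S}_i,F)=ER_\mu(\mathcal{S}_0,F)\le 8r\log(\#A)<\infty.$$
   Context: $A^{\mathbb{Z}^2}$ carries the product of discrete topologies and its Borel $\sigma$-algebra. The shifts are $\sigma^v(x)_u=x_{u+v}$, $u,v\in\mathbb{Z}^2$. Let $E_n=\{(i,j)\in\mathbb{Z}^2: -n\le i,j\le n\}$. A cellular automaton (CA) $F$ is a continuous self-map of $A^{\mathbb{Z}^2}$ commuting with all shifts; equivalently there are $r\in\mathbb{N}$ and $f:A^{E_r}\to A$ with $F(x)_z=f\big((x_{z+u})_{u\in E_r}\big)$ for all $z$; such an $r$ is called the radius of $F$. For $n\ge r$, $E'_n=E_n\setminus E_{n-r}$. For a finite measurable partition $\mathcal{P}$ of $A^{\mathbb{Z}^2}$, $\mathcal{P}_n=\bigvee_{v\in E_n}\sigma^v(\mathcal{P})$ and $\mathcal{P}'_n=\bigvee_{v\in E'_n}\sigma^v(\mathcal{P})$. $\mathcal{S}_0$ is the partition according to the value of the coordinate at $(0,0)$, and $\mathcal{S}_n=(\mathcal{S}_0)_n$ is the partition according to the pattern on $E_n$. $h_\mu(\mathcal{P},F)=\lim_{N}\frac1N H_\mu(\bigvee_{i=0}^{N-1}F^{-i}\mathcal{P})$ with $H_\mu$ the Shannon entropy of a partition (natural logarithm). For an $F$-invariant probability measure $\mu$, $ER_\mu(\mathcal{P},F)=\limsup_{n\to\infty}\frac1n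 h_\mu(\mathcal{P}'_n,F)$. *)

theory Defs
  imports "HOL-Probability.Probability"
begin

(* The finite alphabet is a type 'a :: finite.  It carries no topology of its own, so the product
   of discrete topologies on configurations is given explicitly. *)
type_synonym 'a config = "int \<times> int \<Rightarrow> 'a"

definition config_topology :: "'a config topology" where
  "config_topology = product_topology (\<lambda>_. discrete_topology UNIV) UNIV"

definition config_borel :: "'a config measure" where
  "config_borel = sigma UNIV {U. openin config_topology U}"

definition shift :: "int \<times> int \<Rightarrow> 'a config \<Rightarrow> 'a config" where
  "shift v x = (\<lambda>u. x (u + v))"

definition square :: "nat \<Rightarrow> (int \<times> int) set" where
  "square n = {- int n..int n} \<times> {- int n..int n}"

(* Intended for n >= r.  For n < r the subtraction truncates; this affects only finitely many n
   and hence not the limit superior below. *)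
definition square_ring :: "nat \<Rightarrow> nat \<Rightarrow> (int \<times> int) set" where
  "square_ring r n = square n - square (n - r)"

definition cellular_automaton :: "('a config \<Rightarrow> 'a config) \<Rightarrow> bool" where
  "cellular_automaton F \<longleftrightarrow>
     continuous_map config_topology config_topology F \<and>
     (\<forall>v x. F (shift v x) = shift v (F x))"

definition has_radius :: "('a config \<Rightarrow> 'a config) \<Rightarrow> nat \<Rightarrow> bool" where
  "has_radius F r \<longleftrightarrow>
     (\<exists>f :: (int \<times> int \<Rightarrow> 'a) \<Rightarrow> 'a. \<forall>x z. F x z = f (restrict (\<lambda>u. x (z + u)) (square r)))"

definition invariant_probability :: "'a config measure \<Rightarrow> ('a config \<Rightarrow> 'a config) \<Rightarrow> bool" where
  "invariant_probability \<mu> F \<longleftrightarrow>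
     prob_space \<mu> \<and> sets \<mu> = sets config_borel \<and> distr \<mu> \<mu> F = \<mu>"

(* Partitions are sets of nonempty sets, as in partition_on; common_refinement is their join.
   The join of no partitions is {UNIV}. *)
definition shift_partition :: "int \<times> int \<Rightarrow> 'a config set set \<Rightarrow> 'a config set set" where
  "shift_partition v P = (\<lambda>C. shift v ` C) ` P"

(* The map need not be surjective, so empty preimages are discarded. *)
definition preimage_partition ::
    "('a config \<Rightarrow> 'a config) \<Rightarrow> 'a config set set \<Rightarrow> 'a config set set" where
  "preimage_partition G P = (\<lambda>C. G -` C) ` P - {{}}"

definition square_join :: "'a config set set \<Rightarrow> nat \<Rightarrow> 'a config set set" where
  "square_join P n = common_refinement ((\<lambda>v. shift_partition v P) ` square n)"

definition ring_join :: "nat \<Rightarrow> 'a config set set \<Rightarrow> nat \<Rightarrow> 'a config set set" where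
  "ring_join r P n = common_refinement ((\<lambda>v. shift_partition v P) ` square_ring r n)"

definition origin_partition :: "'a config set set" where
  "origin_partition = range (\<lambda>a. {x. x (0, 0) = a})"

definition pattern_partition :: "nat \<Rightarrow> 'a config set set" where
  "pattern_partition n = square_join origin_partition n"

(* Since ln 0 = 0, null atoms contribute 0. *)
definition partition_entropy :: "'a config measure \<Rightarrow> 'a config set set \<Rightarrow> real" where
  "partition_entropy \<mu> P = - (\<Sum>C\<in>P. measure \<mu> C * ln (measure \<mu> C))"

definition dynamical_entropy ::
    "'a config measure \<Rightarrow> 'a config set set \<Rightarrow> ('a config \<Rightarrow> 'a config) \<Rightarrow> real" where
  "dynamical_entropy \<mu> P F =
     lim (\<lambda>N. partition_entropy \<mu>
                (common_refinement ((\<lambda>i. preimage_partition (F ^^ i) P) ` {..<N})) / real N)"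

definition entropy_rate ::
    "nat \<Rightarrow> 'a config measure \<Rightarrow> 'a config set set \<Rightarrow> ('a config \<Rightarrow> 'a config) \<Rightarrow> ereal" where
  "entropy_rate r \<mu> P F =
     limsup (\<lambda>n. ereal (dynamical_entropy \<mu> (ring_join r P n) F / real n))"

end

theory Submission
  imports Defs
begin

text \<open>
  Write \<open>h W\<close> for the dynamical entropy of the partition according to the pattern on a finite
  window \<open>W\<close>. If the initial pattern on \<open>E\<^sub>n\<close> is known, then the successive patterns on the ring
  \<open>E'\<^sub>n\<close> of width \<open>r\<close> determine all later patterns on \<open>E\<^sub>n\<close>, since the next state of a cell outside
  the ring only depends on cells of \<open>E\<^sub>n\<close>. The initial pattern has finite entropy, which disappears
  after division by the time, so \<open>h E'\<^sub>n = h E\<^sub>n\<close>. For \<open>r > 0\<close>, the window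
  \<open>E'\<^sub>n + E\<^sub>i\<close> lies between \<open>E'\<^sub>n\<^sub>+\<^sub>i\<close> and \<open>E\<^sub>n\<^sub>+\<^sub>i\<close>, so its entropy is \<open>h E\<^sub>n\<^sub>+\<^sub>i\<close>.
  As \<open>h E'\<^sub>n\<close> is at most the number of cells of \<open>E'\<^sub>n\<close> times \<open>ln CARD('a)\<close>, the
  entropies grow at most linearly, and the shift by \<open>i\<close> does not affect the limit superior.
\<close>

section \<open>Limits of real sequences\<close>

text \<open>Fekete's lemma: the limit is the infimum of the ratios over \<open>n \<ge> 1\<close>,
  and division with remainder by an almost optimal \<open>k\<close> bounds \<open>a n\<close> from
  above. It shows that the \<open>lim\<close> in \<open>dynamical_entropy\<close> is a genuine
  limit.\<close>

lemma subadditive_ratio_convergent: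
  fixes a :: "nat \<Rightarrow> real"
  assumes sub: "\<And>m n. a (m + n) \<le> a m + a n" and nn: "\<And>n. 0 \<le> a n"
  shows "convergent (\<lambda>n. a n / real n)"
proof -
  define L where "L = (INF n\<in>{1..}. a n / real n)"
  have bdd: "bdd_below ((\<lambda>n. a n / real n) ` {1..})"
    by (rule bdd_belowI2[of _ 0]) (simp add: nn)
  have lower: "L \<le> a n / real n" if "n \<ge> 1" for n
    unfolding L_def using that by (intro cINF_lower bdd) auto
  \<comment> \<open>The summand \<open>a 0\<close> serves the case \<open>q = 0\<close>, as
    \<open>a 0\<close> may be positive.\<close>
  have mult: "a (q * k) \<le> real q * a k + a 0" for q k
  proof (induction q)
    case (Suc q)
    then show ?case
      using sub[of k "q * k"] by (simp add: algebra_simps)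
  qed simp
  have "(\<lambda>n. a n / real n) \<longlonglongrightarrow> L"
  proof (rule LIMSEQ_I)
    fix e :: real
    assume e: "e > 0"
    have "\<exists>k\<in>{1..}. a k / real k < L + e / 2"
      using e bdd unfolding L_def by (subst cINF_less_iff[symmetric]) auto
    then obtain k where k: "k \<ge> 1" "a k / real k < L + e / 2"
      by auto
    \<comment> \<open>\<open>M\<close> collects what does not grow with \<open>n\<close>: the
      \<open>a 0\<close> from \<open>mult\<close>, and a bound for \<open>a (n mod k)\<close> that
      is uniform in the remainder.\<close>
    define M where "M = a 0 + (\<Sum>s<k. a s)"
    have bound: "a n \<le> real n * (a k / real k) + M" for n
    proof -
      have "a n \<le> a (n div k * k) + a (n mod k)"
        using sub[of "n div k * k" "n mod k"] by simp
      moreover have "a (n mod k) \<le> (\<Sum>s<k. a s)"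
        using k nn by (intro member_le_sum) auto
      moreover have "real (n div k) * a k \<le> real n / real k * a k"
        by (intro mult_right_mono of_nat_div_le_of_nat nn)
      ultimately show ?thesis
        using mult[of "n div k" k] unfolding M_def by simp
    qed
    obtain n0 :: nat where n0: "2 * M / e < real n0"
      using reals_Archimedean2 by blast
    show "\<exists>no. \<forall>n\<ge>no. norm (a n / real n - L) < e"
    proof (intro exI allI impI)
      fix n
      assume n: "n \<ge> max 1 n0"
      then have "2 * M / e < real n"
        using n0 by linarith
      then have M: "M / real n < e / 2"
        using e n by (simp add: field_simps)
      have "a n / real n \<le> (real n * (a k / real k) + M) / real n"
        by (intro divide_right_mono bound) simp
      also have "\<dots> = a k / real k + M / real n"
        using n by (simp add: add_divide_distrib)
      finally have "a n / real n < L + e"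
        using k M by linarith
      then show "norm (a n / real n - L) < e"
        using lower[of n] n by auto
    qed
  qed
  then show ?thesis
    by (rule convergentI)
qed

text \<open>Replacing the denominator \<open>n\<close> by \<open>n + i\<close> changes the ratio by
  \<open>s (n + i) * i / (n * (n + i))\<close>. Linear growth of \<open>s\<close> bounds this by
  \<open>C * i / n\<close>, which vanishes; what remains is a tail of the same sequence.\<close>

lemma limsup_ratio_shift:
  fixes s :: "nat \<Rightarrow> real"
  assumes nn: "\<And>m. 0 \<le> s m" and bnd: "\<And>m. s m \<le> C * real m"
  shows "limsup (\<lambda>n. ereal (s (n + i) / real n)) = limsup (\<lambda>n. ereal (s n / real n))"
proof -
  define d where "d n = s (n + i) / real n - s (n + i) / real (n + i)" for n
  have C: "0 \<le> C"
    using order_trans[OF nn bnd[of 1]] by simp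
  have "d \<longlonglongrightarrow> 0"
  proof (rule tendsto_sandwich)
    show "\<forall>\<^sub>F n in sequentially. 0 \<le> d n"
      using eventually_gt_at_top[of 0]
      by eventually_elim (auto simp: d_def intro!: divide_left_mono nn)
    show "\<forall>\<^sub>F n in sequentially. d n \<le> (C * real i) / real n"
      using eventually_gt_at_top[of 0]
    proof eventually_elim
      case (elim n)
      have "d n = s (n + i) * real i / (real n * real (n + i))"
        using elim by (simp add: d_def field_simps)
      also have "\<dots> \<le> (C * real (n + i)) * real i / (real n * real (n + i))"
        using bnd[of "n + i"] by (intro divide_right_mono mult_right_mono) auto
      also have "\<dots> = (C * real i * real (n + i)) / (real n * real (n + i))"
        by (simp only: ac_simps)
      also have "\<dots> = (C * real i) / real n"
        using elim by (subst mult_divide_mult_cancel_right) auto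
      finally show ?case .
    qed
    show "(\<lambda>n. C * real i / real n) \<longlonglongrightarrow> 0"
      by (rule lim_const_over_n)
  qed auto
  then have d: "(\<lambda>n. ereal (d n)) \<longlonglongrightarrow> 0"
    by (simp add: zero_ereal_def)
  have "limsup (\<lambda>n. ereal (s (n + i) / real n)) =
      limsup (\<lambda>n. ereal (d n) + ereal (s (n + i) / real (n + i)))"
    by (simp add: d_def)
  also have "\<dots> = 0 + limsup (\<lambda>n. ereal (s (n + i) / real (n + i)))"
    by (rule ereal_limsup_lim_add[OF d]) simp
  finally show ?thesis
    using limsup_shift_k[of "\<lambda>n. ereal (s n / real n)" i] by simp
qed

lemma restrict_eq_iff: "restrict f W = restrict g W \<longleftrightarrow> (\<forall>w\<in>W. f w = g w)"
  by (metis restrict_apply' restrict_ext)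

section \<open>Partitions into fibers\<close>

text \<open>Ranging over points instead of values excludes empty blocks, as the convention for
  partitions demands. Joins, preimages and shifts of partitions then become operations on
  observables.\<close>

definition fibers :: "('x \<Rightarrow> 'b) \<Rightarrow> 'x set set" where
  "fibers g = range (\<lambda>x. g -` {g x})"

lemma fibers_cong: "(\<And>x y. g x = g y \<longleftrightarrow> h x = h y) \<Longrightarrow> fibers g = fibers h"
  unfolding fibers_def by (intro image_cong) (auto simp: vimage_def)

lemma fibers_memD: "C \<in> fibers g \<Longrightarrow> x \<in> C \<Longrightarrow> C = g -` {g x}"
  unfolding fibers_def by auto

text \<open>A block of the join that contains \<open>x\<close> must pick the block of
  \<open>x\<close> from every partition, so it is the fiber of the tuple of observables through
  \<open>x\<close>. For empty \<open>J\<close> the tuple is constant and the only block is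
  \<open>UNIV\<close>.\<close>

lemma common_refinement_fibers:
  "common_refinement ((\<lambda>j. fibers (g j)) ` J) = fibers (\<lambda>x. restrict (\<lambda>j. g j x) J)"
  (is "common_refinement ?\<P> = fibers ?G")
proof -
  have fib: "?G -` {?G x} = (\<Inter>j\<in>J. g j -` {g j x})" for x
    by (auto simp: restrict_eq_iff)
  show ?thesis
  proof (intro equalityI subsetI)
    fix C
    assume "C \<in> common_refinement ?\<P>"
    then obtain f x where f: "f \<in> (\<Pi> P\<in>?\<P>. P)" and C: "C = \<Inter> (f ` ?\<P>)" and x: "x \<in> C"
      by (auto simp: common_refinement)
    have "f (fibers (g j)) = g j -` {g j x}" if "j \<in> J" for j
      using f x C that by (intro fibers_memD) auto
    then have "C = ?G -` {?G x}"
      unfolding fib C by (auto simp: image_image)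
    then show "C \<in> fibers ?G"
      by (auto simp: fibers_def)
  next
    fix C
    assume "C \<in> fibers ?G"
    then obtain x where C: "C = ?G -` {?G x}"
      by (auto simp: fibers_def)
    \<comment> \<open>The choice has to depend on the partition and not on its index, since several
      \<open>j\<close> may give the same partition. On a partition into fibers, the union is over
      the single block of \<open>x\<close>.\<close>
    define f where "f P = \<Union>{B \<in> P. x \<in> B}" for P :: "'a set set"
    have f: "f (fibers h) = h -` {h x}" for h :: "'a \<Rightarrow> 'c"
      by (auto simp: f_def fibers_def)
    have "f \<in> (\<Pi> P\<in>?\<P>. P)"
      using f by (auto simp: fibers_def)
    moreover have "C = \<Inter> (f ` ?\<P>)"
      unfolding C fib by (simp add: f image_image)
    moreover have "C \<noteq> {}"
      unfolding C by auto
    ultimately show "C \<in> common_refinement ?\<P>"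
      unfolding common_refinement by blast
  qed
qed

lemma preimage_partition_fibers: "preimage_partition G (fibers g) = fibers (g \<circ> G)"
proof (intro equalityI subsetI)
  fix C
  assume "C \<in> preimage_partition G (fibers g)"
  \<comment> \<open>The value \<open>y\<close> itself need not be attained after \<open>G\<close>;
    nonemptiness supplies a point \<open>x\<close> whose image has the same value.\<close>
  then obtain y x where "C = G -` (g -` {g y})" "x \<in> C"
    by (auto simp: preimage_partition_def fibers_def)
  then have "C = (g \<circ> G) -` {(g \<circ> G) x}"
    by auto
  then show "C \<in> fibers (g \<circ> G)"
    by (auto simp: fibers_def)
next
  fix C
  assume "C \<in> fibers (g \<circ> G)"
  then obtain x where "C = (g \<circ> G) -` {(g \<circ> G) x}"
    by (auto simp: fibers_def)
  then have "C = G -` (g -` {g (G x)})" "x \<in> C"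
    by auto
  then show "C \<in> preimage_partition G (fibers g)"
    by (auto simp: preimage_partition_def fibers_def)
qed

section \<open>Shifted partitions and windows\<close>

lemma shift_shift: "shift u (shift v x) = shift (u + v) x"
  by (simp add: shift_def add.assoc)

lemma shift_0 [simp]: "shift 0 x = x"
  by (simp add: shift_def)

text \<open>\<open>shift v\<close> is a bijection with inverse \<open>shift (- v)\<close>, so its
  images are preimages under the inverse. Surjectivity then allows the base points of the fibers to
  be renamed.\<close>

lemma shift_partition_fibers: "shift_partition v (fibers g) = fibers (g \<circ> shift (- v))"
proof -
  have im: "shift v ` C = shift (- v) -` C" for C :: "'a config set"
  proof (intro equalityI subsetI)
    fix y :: "'a config"
    assume "y \<in> shift (- v) -` C"
    then have "shift v (shift (- v) y) \<in> shift v ` C"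
      by (intro imageI) simp
    then show "y \<in> shift v ` C"
      by (simp add: shift_shift)
  qed (auto simp: shift_shift)
  have surj: "range (shift (- v)) = (UNIV :: 'a config set)"
    using im[of UNIV] by (metis surj_def shift_shift shift_0 left_minus)
  have "shift_partition v (fibers g) = range (\<lambda>x. (g \<circ> shift (- v)) -` {g x})"
    unfolding shift_partition_def fibers_def image_image im by (simp add: vimage_comp)
  also have "\<dots> = (\<lambda>x. (g \<circ> shift (- v)) -` {g x}) ` range (shift (- v))"
    by (simp only: surj)
  finally show ?thesis
    by (simp add: fibers_def image_image)
qed

text \<open>Coordinate \<open>w\<close> of \<open>shift (- v) x\<close> is \<open>x (w - v)\<close>,
  so the join over \<open>V\<close> reads exactly the cells of \<open>W - V\<close>. The minus sign
  arises because blocks are moved by images.\<close>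

lemma shift_join_fibers:
  "common_refinement ((\<lambda>v. shift_partition v (fibers (\<lambda>x. restrict x W))) ` V) =
   fibers (\<lambda>x. restrict x ((\<lambda>(v, w). w - v) ` (V \<times> W)))"
  unfolding shift_partition_fibers common_refinement_fibers
  by (rule fibers_cong) (auto simp: restrict_eq_iff shift_def)

lemma origin_partition_fibers: "origin_partition = fibers (\<lambda>x. restrict x {0})"
proof -
  have "range (\<lambda>x :: 'a config. x 0) = UNIV"
    by (auto intro!: range_eqI[of _ _ "\<lambda>_. _"])
  then have "origin_partition = (\<lambda>a. {x. x 0 = a}) ` range (\<lambda>x :: 'a config. x 0)"
    by (simp add: origin_partition_def zero_prod_def)
  then show ?thesis
    by (auto simp: fibers_def image_image restrict_eq_iff vimage_def)
qed

lemma square_uminus: "v \<in> square n \<Longrightarrow> - v \<in> square n"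
  by (auto simp: square_def)

lemma square_ring_uminus: "v \<in> square_ring r n \<Longrightarrow> - v \<in> square_ring r n"
  using square_uminus[of "- v" "n - r"] by (auto simp: square_ring_def square_uminus)

text \<open>Squares and rings are symmetric about the origin, which removes the sign introduced by
  \<open>shift_join_fibers\<close>.\<close>

lemma uminus_image_symmetric:
  fixes V :: "'b :: group_add set"
  assumes "\<And>v. v \<in> V \<Longrightarrow> - v \<in> V"
  shows "uminus ` V = V"
proof (intro equalityI subsetI)
  fix v
  assume "v \<in> V"
  then have "- (- v) \<in> uminus ` V"
    by (intro imageI assms)
  then show "v \<in> uminus ` V"
    by simp
qed (auto intro: assms)

lemma times_zero_diff_image: "(\<lambda>(v, w). w - v) ` (V \<times> {0}) = uminus ` (V :: (int \<times> int) set)"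
  by force

lemma pattern_partition_fibers: "pattern_partition i = fibers (\<lambda>x. restrict x (square i))"
  unfolding pattern_partition_def square_join_def origin_partition_fibers shift_join_fibers
  by (simp add: times_zero_diff_image uminus_image_symmetric square_uminus)

lemma ring_join_origin:
  "ring_join r origin_partition n = fibers (\<lambda>x. restrict x (square_ring r n))"
  unfolding ring_join_def origin_partition_fibers shift_join_fibers
  by (simp add: times_zero_diff_image uminus_image_symmetric square_ring_uminus)

section \<open>Geometry of rings\<close>

text \<open>This is the sumset of \<open>E'_n\<close> and \<open>E_i\<close>, because the ring is
  symmetric; the difference form is the one that \<open>shift_join_fibers\<close> yields.\<close>

definition thick_ring :: "nat \<Rightarrow> nat \<Rightarrow> nat \<Rightarrow> (int \<times> int) set" where
  "thick_ring r i n = (\<lambda>(v, w). w - v) ` (square_ring r n \<times> square i)"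

lemma ring_join_pattern:
  "ring_join r (pattern_partition i) n = fibers (\<lambda>x. restrict x (thick_ring r i n))"
  unfolding ring_join_def pattern_partition_fibers shift_join_fibers thick_ring_def ..

lemma finite_square [simp]: "finite (square n)"
  by (simp add: square_def)

lemma finite_square_ring [simp]: "finite (square_ring r n)"
  by (simp add: square_ring_def)

lemma thick_ring_subset: "thick_ring r i n \<subseteq> square (n + i)"
  by (auto simp: thick_ring_def square_ring_def square_def)

lemma square_ring_subset_thick:
  assumes "0 < r" "r \<le> n"
  shows "square_ring r (n + i) \<subseteq> thick_ring r i n"
proof
  fix u
  assume u: "u \<in> square_ring r (n + i)"
  obtain p q where pq: "u = (p, q)"
    by fastforce
  \<comment> \<open>Clamping both coordinates gives the cell of \<open>E_n\<close> nearest to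
    \<open>u\<close>, at distance at most \<open>i\<close> in each coordinate. It lies in the ring:
    a clamped coordinate has absolute value \<open>n > n - r\<close> because \<open>r > 0\<close>,
    and otherwise \<open>u\<close> is itself outside \<open>E_(n-r)\<close>. The signs of the
    witness match the \<open>w - v\<close> in \<open>thick_ring\<close>.\<close>
  define c where "c t = max (- int n) (min (int n) t)" for t :: int
  have "(- c p, - c q) \<in> square_ring r n"
    using u assms unfolding pq c_def square_ring_def square_def by (auto simp: of_nat_diff)
  moreover have "(p - c p, q - c q) \<in> square i"
    using u unfolding pq c_def square_ring_def square_def by auto
  moreover have "u = (p - c p, q - c q) - (- c p, - c q)"
    by (simp add: pq)
  ultimately show "u \<in> thick_ring r i n"
    unfolding thick_ring_def by (intro image_eqI[of _ _ "((- c p, - c q), (p - c p, q - c q))"]) auto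
qed

lemma card_square: "card (square n) = (2 * n + 1)\<^sup>2"
  by (simp add: square_def card_cartesian_product power2_eq_square nat_add_distrib nat_mult_distrib)

text \<open>The constant 8 comes from the difference of two squares, whose correction term
  \<open>4 * r * (r - 1)\<close> is nonnegative for natural \<open>r\<close>.\<close>

lemma card_square_ring:
  assumes "r \<le> n"
  shows "real (card (square_ring r n)) \<le> 8 * real r * real n"
proof -
  have "square (n - r) \<subseteq> square n"
    by (auto simp: square_def)
  then have "card (square_ring r n) = card (square n) - card (square (n - r))"
      and le: "card (square (n - r)) \<le> card (square n)"
    by (auto simp: square_ring_def card_Diff_subset card_mono)
  then have "real (card (square_ring r n)) = (2 * real n + 1)\<^sup>2 - (2 * (real n - real r) + 1)\<^sup>2"
    using assms by (simp add: card_square algebra_simps)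
  also have "\<dots> = 8 * real r * real n - 4 * (real r * (real r - 1))"
    by (simp add: power2_eq_square algebra_simps)
  finally show ?thesis
    by (cases r) auto
qed

section \<open>Entropy of observables\<close>

text \<open>The single observable whose fibers are the join of the first \<open>N\<close> preimage
  partitions; the restriction makes equality ignore later times.\<close>

definition itinerary :: "('x \<Rightarrow> 'x) \<Rightarrow> ('x \<Rightarrow> 'b) \<Rightarrow> nat \<Rightarrow> 'x \<Rightarrow> nat \<Rightarrow> 'b" where
  "itinerary F g N x = restrict (\<lambda>i. g ((F ^^ i) x)) {..<N}"

lemma itinerary_eq_iff:
  "itinerary F g N x = itinerary F g N y \<longleftrightarrow> (\<forall>i<N. g ((F ^^ i) x) = g ((F ^^ i) y))"
  by (auto simp: itinerary_def restrict_eq_iff)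

lemma dynamical_entropy_fibers:
  "dynamical_entropy \<mu> (fibers g) F =
   lim (\<lambda>N. partition_entropy \<mu> (fibers (itinerary F g N)) / real N)"
proof -
  have "itinerary F g N = (\<lambda>x. restrict (\<lambda>i. (g \<circ> F ^^ i) x) {..<N})" for N
    by (simp add: itinerary_def fun_eq_iff)
  then show ?thesis
    by (simp add: dynamical_entropy_def preimage_partition_fibers common_refinement_fibers)
qed

text \<open>A tuple of finitely many finite-valued observables has finitely many values, and each of
  its fibers is a finite intersection of measurable fibers.\<close>

lemma simple_function_restrict:
  assumes "finite J" "\<And>j. j \<in> J \<Longrightarrow> simple_function M (g j)"
  shows "simple_function M (\<lambda>x. restrict (\<lambda>j. g j x) J)" (is "simple_function M ?G")
  unfolding simple_function_def
proof (intro conjI ballI)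
  have "?G ` space M \<subseteq> (\<Pi>\<^sub>E j\<in>J. g j ` space M)"
    by auto
  then show "finite (?G ` space M)"
    using assms by (auto intro!: finite_PiE simple_functionD(1) elim!: finite_subset)
  fix c
  assume "c \<in> ?G ` space M"
  then obtain y where y: "c = ?G y"
    by auto
  have "?G -` {c} \<inter> space M = {x \<in> space M. \<forall>j\<in>J. g j x = g j y}"
    by (auto simp: y restrict_eq_iff)
  also have "\<dots> \<in> sets M"
  proof (rule sets.sets_Collect_finite_All)
    fix j
    assume "j \<in> J"
    then have "g j -` {g j y} \<inter> space M \<in> sets M"
      by (intro simple_functionD(2) assms)
    moreover have "g j -` {g j y} \<inter> space M = {x \<in> space M. g j x = g j y}"
      by auto
    ultimately show "{x \<in> space M. g j x = g j y} \<in> sets M"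
      by simp
  qed (use assms in auto)
  finally show "?G -` {c} \<inter> space M \<in> sets M" .
qed

text \<open>The base \<open>exp 1\<close> turns the logarithm of the information-theoretic notions
  into \<open>ln\<close>.\<close>

locale measure_preserving = information_space \<mu> "exp 1" for \<mu> :: "'a config measure" +
  fixes F :: "'a config \<Rightarrow> 'a config"
  assumes space_UNIV: "space \<mu> = UNIV"
    and F_measurable: "F \<in> measurable \<mu> \<mu>"
    and F_invariant: "distr \<mu> \<mu> F = \<mu>"
begin

abbreviation H :: "('a config \<Rightarrow> 'b) \<Rightarrow> real" where
  "H g \<equiv> partition_entropy \<mu> (fibers g)"

lemma H_eq_sum: "H g = - (\<Sum>c\<in>range g. prob (g -` {c}) * ln (prob (g -` {c})))"
proof -
  have "fibers g = (\<lambda>c. g -` {c}) ` range g"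
    by (simp add: fibers_def image_image)
  moreover have "inj_on (\<lambda>c. g -` {c}) (range g)"
    by (auto simp: inj_on_def)
  ultimately show ?thesis
    by (simp add: partition_entropy_def sum.reindex)
qed

lemma H_eq_entropy:
  assumes "simple_function \<mu> g"
  shows "H g = entropy (exp 1) (count_space (range g)) g"
  using entropy_simple_distributed[OF simple_distributedI[OF assms measure_nonneg refl]]
  by (simp add: H_eq_sum space_UNIV log_def)

lemma H_nonneg: "0 \<le> H g"
proof -
  have "prob A * ln (prob A) \<le> 0" for A
    by (cases "prob A = 0") (auto simp: mult_le_0_iff zero_less_measure_iff)
  then show ?thesis
    by (simp add: H_eq_sum sum_nonpos)
qed

text \<open>Since \<open>h\<close> determines \<open>g\<close>, the observable \<open>g\<close>
  factors through \<open>h\<close> by way of \<open>inv h\<close>, and processing data does not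
  increase entropy.\<close>

lemma H_mono:
  assumes "simple_function \<mu> h" and det: "\<And>x y. h x = h y \<Longrightarrow> g x = g y"
  shows "H g \<le> H h"
proof -
  have g: "g = (g \<circ> inv h) \<circ> h"
    by (rule ext) (auto intro!: det simp: f_inv_into_f)
  have "simple_function \<mu> g"
    by (subst g) (rule simple_function_compose[OF assms(1)])
  then show ?thesis
    using entropy_data_processing[OF assms(1), of "g \<circ> inv h"] assms(1)
    by (simp add: H_eq_entropy space_UNIV g[symmetric])
qed

text \<open>The chain rule splits off the entropy of \<open>h\<close> given \<open>g\<close>, and
  conditioning does not increase entropy.\<close>

lemma H_Pair_le:
  assumes "simple_function \<mu> g" "simple_function \<mu> h"
  shows "H (\<lambda>x. (g x, h x)) \<le> H g + H h"
  using entropy_chain_rule[OF assms] conditional_entropy_less_eq_entropy[OF assms(2,1)] assms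
  by (simp add: H_eq_entropy space_UNIV)

lemma H_le_card:
  assumes "simple_function \<mu> g" "range g \<subseteq> B" "finite B"
  shows "H g \<le> ln (real (card B))"
proof -
  have "H g \<le> ln (real (card (range g)))"
    using entropy_le_card[OF simple_distributedI[OF assms(1) measure_nonneg refl]] assms(1)
    by (simp add: H_eq_entropy space_UNIV log_def)
  also have "\<dots> \<le> ln (real (card B))"
    using assms card_mono[of B "range g"] card_gt_0_iff[of "range g"]
    by (intro ln_mono) (auto intro: finite_subset)
  finally show ?thesis .
qed

section \<open>Iterates, itineraries and dynamical entropy\<close>

lemma funpow_measurable: "F ^^ n \<in> measurable \<mu> \<mu>"
  proof (induction n)
  case (Suc n)
  then show ?case
    using measurable_comp[OF Suc F_measurable] by (simp only: funpow.simps)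
qed simp

lemma simple_function_funpow:
  assumes "simple_function \<mu> g"
  shows "simple_function \<mu> (\<lambda>x. g ((F ^^ n) x))"
  unfolding simple_function_def
proof (intro conjI ballI)
  show "finite ((\<lambda>x. g ((F ^^ n) x)) ` space \<mu>)"
    using simple_functionD(1)[OF assms] by (rule rev_finite_subset) (auto simp: space_UNIV)
  fix c
  have "g -` {c} \<in> sets \<mu>"
    using simple_functionD(2)[OF assms, of "{c}"] by (simp add: space_UNIV)
  from measurable_sets[OF funpow_measurable this]
  show "(\<lambda>x. g ((F ^^ n) x)) -` {c} \<inter> space \<mu> \<in> sets \<mu>"
    by (simp add: vimage_def)
qed

lemma prob_funpow_vimage:
  assumes "B \<in> sets \<mu>"
  shows "prob ((F ^^ n) -` B) = prob B"
proof (induction n)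
  case (Suc n)
  have *: "(F ^^ n) -` B \<in> sets \<mu>"
    using measurable_sets[OF funpow_measurable assms] by (simp add: space_UNIV)
  have "prob ((F ^^ n) -` B) = measure (distr \<mu> \<mu> F) ((F ^^ n) -` B)"
    by (simp add: F_invariant)
  also have "\<dots> = prob (F -` ((F ^^ n) -` B))"
    using * by (simp add: measure_distr[OF F_measurable] space_UNIV)
  also have "F -` ((F ^^ n) -` B) = (F ^^ Suc n) -` B"
    by (auto simp: funpow_swap1)
  finally show ?case
    using Suc by (simp only:)
qed simp

text \<open>By invariance both observables have the same distribution. The iterate may miss values
  of \<open>g\<close> when \<open>F\<close> is not surjective, but their fibers have probability 0
  and contribute nothing to the sum.\<close>

lemma H_funpow:
  assumes g: "simple_function \<mu> g"
  shows "H (\<lambda>x. g ((F ^^ n) x)) = H g"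
proof -
  let ?t = "\<lambda>B. prob B * ln (prob B)"
  have meas: "g -` {c} \<in> sets \<mu>" for c
    using simple_functionD(2)[OF g, of "{c}"] by (simp add: space_UNIV)
  have fin: "finite (range g)"
    using simple_functionD(1)[OF g] by (simp add: space_UNIV)
  have prb: "prob ((\<lambda>x. g ((F ^^ n) x)) -` {c}) = prob (g -` {c})" for c
    using prob_funpow_vimage[OF meas, of n c] by (simp add: vimage_def)
  have "(\<Sum>c\<in>range (\<lambda>x. g ((F ^^ n) x)). ?t (g -` {c})) = (\<Sum>c\<in>range g. ?t (g -` {c}))"
  proof (rule sum.mono_neutral_left[OF fin])
    show "\<forall>c\<in>range g - range (\<lambda>x. g ((F ^^ n) x)). ?t (g -` {c}) = 0"
    proof
      fix c
      assume "c \<in> range g - range (\<lambda>x. g ((F ^^ n) x))"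
      then have "g ((F ^^ n) x) \<noteq> c" for x
        by blast
      then have "(\<lambda>x. g ((F ^^ n) x)) -` {c} = {}"
        by auto
      then show "?t (g -` {c}) = 0"
        using prb[of c] by simp
    qed
  qed auto
  then show ?thesis
    by (simp add: H_eq_sum prb)
qed

lemma simple_function_itinerary:
  "simple_function \<mu> g \<Longrightarrow> simple_function \<mu> (itinerary F g N)"
  unfolding itinerary_def[abs_def]
  by (intro simple_function_restrict simple_function_funpow) auto

text \<open>Cut the orbit at time \<open>M\<close>: the second piece is an itinerary of length
  \<open>N\<close> started at \<open>(F ^^ M) x\<close>, and invariance gives it the entropy of one
  started at \<open>x\<close>.\<close>

lemma H_itinerary_add:
  assumes g: "simple_function \<mu> g"
  shows "H (itinerary F g (M + N)) \<le> H (itinerary F g M) + H (itinerary F g N)"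
proof -
  let ?h = "\<lambda>x. itinerary F g N ((F ^^ M) x)"
  have h: "simple_function \<mu> ?h"
    by (intro simple_function_funpow simple_function_itinerary g)
  have "H (itinerary F g (M + N)) \<le> H (\<lambda>x. (itinerary F g M x, ?h x))"
  proof (rule H_mono)
    show "simple_function \<mu> (\<lambda>x. (itinerary F g M x, ?h x))"
      by (intro simple_function_Pair h simple_function_itinerary g)
    fix x y
    assume eq: "(itinerary F g M x, ?h x) = (itinerary F g M y, ?h y)"
    show "itinerary F g (M + N) x = itinerary F g (M + N) y"
      unfolding itinerary_eq_iff
    proof (intro allI impI)
      fix i
      assume i: "i < M + N"
      have 1: "\<forall>j<M. g ((F ^^ j) x) = g ((F ^^ j) y)"
        using eq by (simp add: itinerary_eq_iff)
      have 2: "\<forall>j<N. g ((F ^^ (j + M)) x) = g ((F ^^ (j + M)) y)"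
        using eq by (simp add: itinerary_eq_iff funpow_add)
      show "g ((F ^^ i) x) = g ((F ^^ i) y)"
        using 1 2[rule_format, of "i - M"] i by (cases "i < M") auto
    qed
  qed
  also have "\<dots> \<le> H (itinerary F g M) + H ?h"
    by (intro H_Pair_le h simple_function_itinerary g)
  also have "H ?h = H (itinerary F g N)"
    by (intro H_funpow simple_function_itinerary g)
  finally show ?thesis .
qed

lemma dynamical_entropy_LIMSEQ:
  assumes "simple_function \<mu> g"
  shows "(\<lambda>N. H (itinerary F g N) / real N) \<longlonglongrightarrow> dynamical_entropy \<mu> (fibers g) F"
  unfolding dynamical_entropy_fibers convergent_LIMSEQ_iff[symmetric]
  by (intro subadditive_ratio_convergent H_itinerary_add H_nonneg assms)

lemma dynamical_entropy_nonneg: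
  assumes "simple_function \<mu> g"
  shows "0 \<le> dynamical_entropy \<mu> (fibers g) F"
  by (rule LIMSEQ_le_const[OF dynamical_entropy_LIMSEQ[OF assms]]) (auto simp: H_nonneg)

text \<open>A cost \<open>K\<close> that does not depend on the time \<open>N\<close> disappears
  after division by \<open>N\<close>. This is how the knowledge of an initial pattern becomes
  free.\<close>

lemma dynamical_entropy_le:
  assumes "simple_function \<mu> g" "simple_function \<mu> h"
    and le: "\<And>N. H (itinerary F g N) \<le> K + H (itinerary F h N)"
  shows "dynamical_entropy \<mu> (fibers g) F \<le> dynamical_entropy \<mu> (fibers h) F"
proof (rule LIMSEQ_le[OF dynamical_entropy_LIMSEQ])
  show "(\<lambda>N. K / real N + H (itinerary F h N) / real N) \<longlonglongrightarrow> dynamical_entropy \<mu> (fibers h) F"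
    using tendsto_add[OF lim_const_over_n dynamical_entropy_LIMSEQ[OF assms(2)]] by simp
  show "\<exists>N. \<forall>n\<ge>N. H (itinerary F g n) / real n \<le> K / real n + H (itinerary F h n) / real n"
    using le by (auto simp: add_divide_distrib[symmetric] intro!: divide_right_mono)
qed fact

end

section \<open>Cellular automata\<close>

lemma topspace_config_topology [simp]: "topspace config_topology = UNIV"
  by (simp add: config_topology_def)

lemma space_config_borel [simp]: "space config_borel = UNIV"
  by (simp add: config_borel_def space_measure_of_conv)

lemma openin_config_borel: "openin config_topology U \<Longrightarrow> U \<in> sets config_borel"
  by (simp add: config_borel_def)

lemma measurable_continuous_map:
  assumes "continuous_map config_topology config_topology F"
  shows "F \<in> measurable config_borel config_borel"
proof -
  have "F \<in> measurable config_borel (sigma UNIV {U. openin config_topology U})"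
    using openin_continuous_map_preimage[OF assms] openin_config_borel
    by (intro measurable_measure_of) (auto simp: vimage_def)
  then show ?thesis
    by (simp add: config_borel_def)
qed

lemma coordinate_measurable: "{x. x u = a} \<in> sets config_borel"
proof -
  have "continuous_map config_topology (discrete_topology UNIV) (\<lambda>x :: 'a config. x u)"
    unfolding config_topology_def by (rule continuous_map_product_projection) simp
  from openin_continuous_map_preimage[OF this, of "{a}"] show ?thesis
    by (intro openin_config_borel) simp
qed

locale invariant_automaton = measure_preserving \<mu> F
  for \<mu> :: "('a :: finite) config measure" and F +
  fixes r :: nat
  assumes sets_\<mu>: "sets \<mu> = sets config_borel"
    and radius: "has_radius F r"
begin

abbreviation h :: "(int \<times> int) set \<Rightarrow> real" where
  "h W \<equiv> dynamical_entropy \<mu> (fibers (\<lambda>x. restrict x W)) F"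

lemma simple_function_pattern:
  assumes "finite W"
  shows "simple_function \<mu> (\<lambda>x. restrict x W)"
proof (rule simple_function_restrict[OF assms])
  fix w
  show "simple_function \<mu> (\<lambda>x. x w)"
    using coordinate_measurable[of w]
    by (auto simp: simple_function_def sets_\<mu> space_UNIV vimage_def)
qed

lemma F_local:
  assumes "\<And>u. u \<in> square r \<Longrightarrow> x (z + u) = y (z + u)"
  shows "F x z = F y z"
proof -
  obtain f where f: "\<And>x z. F x z = f (restrict (\<lambda>u. x (z + u)) (square r))"
    using radius unfolding has_radius_def by blast
  have "restrict (\<lambda>u. x (z + u)) (square r) = restrict (\<lambda>u. y (z + u)) (square r)"
    using assms by (simp add: restrict_eq_iff)
  then show ?thesis
    by (simp add: f)
qed

lemma h_nonneg: "finite W \<Longrightarrow> 0 \<le> h W"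
  by (intro dynamical_entropy_nonneg simple_function_pattern)

lemma h_mono:
  assumes "W \<subseteq> W'" "finite W'"
  shows "h W \<le> h W'"
proof (rule dynamical_entropy_le)
  show W: "simple_function \<mu> (\<lambda>x. restrict x W)" and W': "simple_function \<mu> (\<lambda>x. restrict x W')"
    using assms by (auto intro: simple_function_pattern finite_subset)
  show "H (itinerary F (\<lambda>x. restrict x W) N) \<le> 0 + H (itinerary F (\<lambda>x. restrict x W') N)" for N
    unfolding add_0
  proof (rule H_mono[OF simple_function_itinerary[OF W']])
    fix x y
    assume "itinerary F (\<lambda>x. restrict x W') N x = itinerary F (\<lambda>x. restrict x W') N y"
    then show "itinerary F (\<lambda>x. restrict x W) N x = itinerary F (\<lambda>x. restrict x W) N y"
      using assms(1) unfolding itinerary_eq_iff restrict_eq_iff by blast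
  qed
qed

lemma h_le_card:
  assumes W: "finite W"
  shows "h W \<le> real (card W) * ln (real CARD('a))"
proof (rule LIMSEQ_le_const2[OF dynamical_entropy_LIMSEQ[OF simple_function_pattern[OF W]]])
  have "H (itinerary F (\<lambda>x. restrict x W) N) / real N \<le> real (card W) * ln (real CARD('a))"
    if "N \<ge> 1" for N
  proof -
    \<comment> \<open>All conceivable itineraries: one pattern on \<open>W\<close> for each of the
      \<open>N\<close> times.\<close>
    let ?B = "\<Pi>\<^sub>E i\<in>{..<N}. \<Pi>\<^sub>E w\<in>W. (UNIV :: 'a set)"
    have "H (itinerary F (\<lambda>x. restrict x W) N) \<le> ln (real (card ?B))"
      using W by (intro H_le_card simple_function_itinerary simple_function_pattern finite_PiE)
        (auto simp: itinerary_def finite_PiE)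
    also have "real (card ?B) = (real CARD('a) ^ card W) ^ N"
      using W by (simp add: card_PiE)
    also have "ln \<dots> = real N * (real (card W) * ln (real CARD('a)))"
      by (simp add: ln_realpow)
    finally show ?thesis
      using that by (simp add: divide_le_eq mult.commute del: restrict_apply)
  qed
  then show "\<exists>N. \<forall>n\<ge>N. H (itinerary F (\<lambda>x. restrict x W) n) / real n
      \<le> real (card W) * ln (real CARD('a))"
    by blast
qed

text \<open>Induction on time. A cell of \<open>E_n\<close> off the ring lies in
  \<open>E_(n-r)\<close>, so its neighbourhood of radius \<open>r\<close> stays in
  \<open>E_n\<close>, where the induction hypothesis applies; on the ring the values agree by
  assumption.\<close>

lemma square_itinerary_determined:
  assumes "r \<le> n"
    and init: "\<And>u. u \<in> square n \<Longrightarrow> x u = y u"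
    and ring: "\<And>j u. j < N \<Longrightarrow> u \<in> square_ring r n \<Longrightarrow> (F ^^ j) x u = (F ^^ j) y u"
  shows "i < N \<Longrightarrow> u \<in> square n \<Longrightarrow> (F ^^ i) x u = (F ^^ i) y u"
proof (induction i arbitrary: u)
  case (Suc i)
  show ?case
  proof (cases "u \<in> square_ring r n")
    case False
    then have "u \<in> square (n - r)"
      using Suc by (auto simp: square_ring_def)
    then have sq: "u + v \<in> square n" if "v \<in> square r" for v
      using that assms(1) by (auto simp: square_def of_nat_diff)
    have "F ((F ^^ i) x) u = F ((F ^^ i) y) u"
    proof (rule F_local)
      fix v :: "int \<times> int"
      assume "v \<in> square r"
      then show "(F ^^ i) x (u + v) = (F ^^ i) y (u + v)"
        using Suc.prems(1) by (intro Suc.IH sq) simp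
    qed
    then show ?thesis
      by simp
  qed (use ring Suc in blast)
qed (use init in simp)

lemma h_square_le:
  assumes "r \<le> n"
  shows "h (square n) \<le> h (square_ring r n)"
proof (rule dynamical_entropy_le)
  show S: "simple_function \<mu> (\<lambda>x. restrict x (square n))"
    and R: "simple_function \<mu> (\<lambda>x. restrict x (square_ring r n))"
    by (simp_all add: simple_function_pattern)
  fix N
  let ?S = "\<lambda>x. restrict x (square n)"
  let ?R = "itinerary F (\<lambda>x. restrict x (square_ring r n)) N"
  \<comment> \<open>The initial pattern on the square plays the role of the constant
    \<open>K\<close>: its entropy \<open>H ?S\<close> is the same for every
    \<open>N\<close>.\<close>
  have "H (itinerary F ?S N) \<le> H (\<lambda>x. (?S x, ?R x))"
  proof (rule H_mono)
    show "simple_function \<mu> (\<lambda>x. (?S x, ?R x))"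
      by (intro simple_function_Pair S simple_function_itinerary R)
    fix x y
    assume eq: "(?S x, ?R x) = (?S y, ?R y)"
    show "itinerary F ?S N x = itinerary F ?S N y"
      using square_itinerary_determined[OF assms, of x y N] eq
      by (simp add: itinerary_eq_iff restrict_eq_iff)
  qed
  also have "\<dots> \<le> H ?S + H ?R"
    by (intro H_Pair_le S simple_function_itinerary R)
  finally show "H (itinerary F ?S N) \<le> H ?S + H ?R" .
qed

lemma h_square_ring:
  assumes "r \<le> n"
  shows "h (square_ring r n) = h (square n)"
  using h_square_le[OF assms] h_mono[of "square_ring r n" "square n"]
  by (auto simp: square_ring_def)

text \<open>The window is squeezed between the ring and the full square of size
  \<open>n + i\<close>, and these two have equal entropy.\<close>

lemma h_thick_ring:
  assumes "0 < r" "r \<le> n"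
  shows "h (thick_ring r i n) = h (square (n + i))"
proof (rule antisym)
  show "h (thick_ring r i n) \<le> h (square (n + i))"
    by (rule h_mono[OF thick_ring_subset finite_square])
  have "finite (thick_ring r i n)"
    by (simp add: thick_ring_def)
  then have "h (square_ring r (n + i)) \<le> h (thick_ring r i n)"
    by (rule h_mono[OF square_ring_subset_thick[OF assms]])
  then show "h (square (n + i)) \<le> h (thick_ring r i n)"
    using assms by (simp add: h_square_ring)
qed

lemma h_square_ring_le:
  assumes "r \<le> n"
  shows "h (square_ring r n) \<le> 8 * real r * ln (real CARD('a)) * real n"
proof -
  have "0 \<le> ln (real CARD('a))"
    by simp
  from mult_right_mono[OF card_square_ring[OF assms] this] h_le_card[of "square_ring r n"]
  show ?thesis
    by (simp add: algebra_simps)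
qed

lemma entropy_rate_pattern:
  "entropy_rate r \<mu> (pattern_partition i) F = entropy_rate r \<mu> origin_partition F"
proof (cases "r = 0")
  \<comment> \<open>With radius 0 all rings and thick rings are empty, so both rates come from the
    same trivial partition.\<close>
  case True
  then have "square_ring r n = {}" "thick_ring r i n = {}" for n
    by (auto simp: square_ring_def thick_ring_def)
  then show ?thesis
    by (simp add: entropy_rate_def ring_join_origin ring_join_pattern)
next
  case False
  \<comment> \<open>The cutoff below \<open>r\<close> makes the linear bound hold for every \<open>m\<close>.\<close>
  define s where "s m = (if r \<le> m then h (square m) else 0)" for m
  have "entropy_rate r \<mu> (pattern_partition i) F = limsup (\<lambda>n. ereal (s (n + i) / real n))"
    unfolding entropy_rate_def ring_join_pattern
    \<comment> \<open>For \<open>n \<ge> r\<close> also \<open>n + i \<ge> r\<close>, so the cutoff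
      in \<open>s\<close> is inactive; the finitely many smaller \<open>n\<close> do not affect the
      limit superior.\<close>
    by (rule Limsup_eq, rule eventually_mono[OF eventually_ge_at_top[of r]])
      (use False in \<open>simp add: s_def h_thick_ring\<close>)
  also have "\<dots> = limsup (\<lambda>n. ereal (s n / real n))"
  proof (rule limsup_ratio_shift)
    show "0 \<le> s m" for m
      by (simp add: s_def h_nonneg)
    show "s m \<le> 8 * real r * ln (real CARD('a)) * real m" for m
      using h_square_ring_le[of m] by (simp add: s_def h_square_ring)
  qed
  also have "\<dots> = entropy_rate r \<mu> origin_partition F"
    unfolding entropy_rate_def ring_join_origin
    by (rule Limsup_eq, rule eventually_mono[OF eventually_ge_at_top[of r]])
      (simp add: s_def h_square_ring)
  finally show ?thesis .
qed

lemma entropy_rate_origin_le: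
  "entropy_rate r \<mu> origin_partition F \<le> ereal (8 * real r * ln (real CARD('a)))"
  unfolding entropy_rate_def ring_join_origin
proof (rule Limsup_bounded)
  show "\<forall>\<^sub>F n in sequentially. ereal (h (square_ring r n) / real n)
      \<le> ereal (8 * real r * ln (real CARD('a)))"
    \<comment> \<open>\<open>n \<ge> r\<close> is for the bound on the ring,
      \<open>n \<ge> 1\<close> for the division by \<open>n\<close>.\<close>
    using eventually_ge_at_top[of "max 1 r"]
    by eventually_elim (use h_square_ring_le in \<open>simp add: divide_le_eq\<close>)
qed

end

theorem proposition1:
  fixes F :: "('a::finite) config \<Rightarrow> 'a config"
    and \<mu> :: "'a config measure"
    and r i :: nat
  assumes "cellular_automaton F"
    and "has_radius F r"
    and "invariant_probability \<mu> F"
  shows "entropy_rate r \<mu> (pattern_partition i) F = entropy_rate r \<mu> origin_partition F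
       \<and> entropy_rate r \<mu> origin_partition F \<le> ereal (8 * real r * ln (real CARD('a)))
       \<and> ereal (8 * real r * ln (real CARD('a))) < \<infinity>"
proof -
  have \<mu>: "prob_space \<mu>" "sets \<mu> = sets config_borel" "distr \<mu> \<mu> F = \<mu>"
    using assms(3) by (auto simp: invariant_probability_def)
  \<comment> \<open>Continuity gives Borel measurability, which passes to \<open>\<mu>\<close>
    because it has the same measurable sets.\<close>
  have "F \<in> measurable \<mu> \<mu>"
    using measurable_continuous_map[of F] assms(1) measurable_cong_sets[OF \<mu>(2) \<mu>(2)]
    by (simp add: cellular_automaton_def)
  moreover have "space \<mu> = UNIV"
    using sets_eq_imp_space_eq[OF \<mu>(2)] by simp
  ultimately interpret invariant_automaton \<mu> F r
    using \<mu> assms(2)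
    by (simp add: invariant_automaton_def invariant_automaton_axioms_def measure_preserving_def
        measure_preserving_axioms_def information_space_def information_space_axioms_def)
  show ?thesis
    by (simp add: entropy_rate_pattern entropy_rate_origin_le)
qed

end
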